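(* Suppose the updating rule $\Pi$ satisfies BERHR and $P_0\in(0,1]$. Let $\theta=\{\theta_t\}_{t\in\mathbb{N}_0}$ be the compressing sequence $\theta_t=1/(t+2)$. Then the small step-size version $P^\theta$ of the performance measure started at $P_0$ satisfies $\mathbb{P}(P^\theta_\infty=1)=1$, where $P^\theta_\infty=\lim_{t\uparrow\infty}P^\theta_t$.
   Context: Setting. $(\Omega,\mathcal{F})=(\prod_{t=1}^\infty\Omega_t,\otimes_{t=1}^\infty\mathcal{F}_t)$ is a product of measurable spaces with a probability measure $\mathbb{P}$. For $t\in\mathbb{N}$, $\mathcal{F}_{[0,t]}$ denotes the sigma-algebra on $\Omega$ generated by the first $t$ coordinates (i.e. $\otimes_{\tau=1}^t\mathcal{F}_\tau$), and $\mathcal{F}_{[0,0]}=\{\emptyset,\Omega\}$. $\mathbb{E}_t[\cdot]$ is conditional expectation given $\mathcal{F}_{[0,t]}$. $\mathbb{N}_0=\{0,1,2,\dots\}$. (In)equalities between random variables are meant almost surely. Updating rule. A sequence $\Pi=\{\Pi_t\}_{t\in\mathbb{N}}$ of functions $\Pi_t:\Omega\times[0,1]\to[0,1]$ such that $\Pi_t(\cdot,p)$ is $\mathcal{F}_{[0,t]}$-measurable for every $p\in[0,1]$; $\Pi_t$ is taken jointly measurable with respect to $\mathcal{F}_{[0,t]}\otimes\mathcal{B}([0,1])$. The first argument is omitted: $\Pi_t(p)=\Pi_t(\cdot,p)$. WBERHR and BERHR. $\Pi$ satisfies WBERHR (weakly bounded expected relative hazard rates property) with lower bound sequence $\delta=\{\delta_t\}_{t\in\mathbb{N}_0}$,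 where each $\delta_t\ge 0$ is a real-valued $\mathcal{F}_{[0,t]}$-measurable random variable, if $$\mathbb{E}_t[\Pi_{t+1}(p)]-p\ \ge\ \delta_t\,p(1-p)$$ for all $t\in\mathbb{N}_0$ and all $p\in[0,1]$; this is understood to hold also when $p$ is replaced by any $[0,1]$-valued $\mathcal{F}_{[0,t]}$-measurable random variable $p$ (with $\Pi_{t+1}(p)$ meaning $\omega\mapsto\Pi_{t+1}(\omega,p(\omega))$). $\Pi$ satisfies BERHR (bounded expected relative hazard rates property) if it satisfies WBERHR with some lower bound sequence $\delta$ such that $\inf_{t\in\mathbb{N}_0}\delta_t>0$ (almost surely; the infimum is a random variable and need not be uniformly bounded away from zero in $\omega$). Small step-size version. A compressing sequence is a sequence $\theta=\{\theta_t\}_{t\in\mathbb{N}_0}$ of $\mathcal{F}_{[0,t]}$-measurable random variables $\theta_t\in(0,1]$. Set $\Pi^\theta_t(p):=p+\theta_{t-1}(\Pi_t(p)-p)$ for $p\in[0,1]$, $t\in\mathbb{N}$, and define $P^\theta_0=P_0$, $P^\theta_t=\Pi^\theta_t(P^\theta_{t-1})$ for $t\in\mathbb{N}$. Under WBERHR, $P^\theta$ is a bounded submartingale, so $P^\theta_\infty=\lim_{t\uparrow\infty}P^\theta_t$ exists almost surely. *)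

theory Defs
  imports "HOL-Probability.Probability"
begin

text \<open>
  The sample space is the countable product \<open>Pi\<^sub>M {1..} N\<close>; only the spaces and sigma-algebras of
  the factors \<open>N t\<close> matter, their measures play no role. Factors at different times are subsets
  of one type, which may be taken to be a sum type if the factors are of different nature.
\<close>

definition filt :: "(nat \<Rightarrow> 'a measure) \<Rightarrow> nat \<Rightarrow> (nat \<Rightarrow> 'a) measure" where
  "filt N t = vimage_algebra (space (Pi\<^sub>M {1..} N)) (\<lambda>\<omega>. restrict \<omega> {1..t}) (Pi\<^sub>M {1..t} N)"

lemma sets_filt_0:
  fixes N :: "nat \<Rightarrow> 'a measure"
  shows "sets (filt N 0) = {{}, space (Pi\<^sub>M {1..} N)}"
proof -
  have "(\<lambda>\<omega>. restrict \<omega> {1..0}) \<in> space (Pi\<^sub>M {1..} N) \<rightarrow> space (Pi\<^sub>M {1..0::nat} N)"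
    by (simp add: space_PiM_empty restrict_def)
  then have "sets (filt N 0) =
      {(\<lambda>\<omega>. restrict \<omega> {1..0}) -` A \<inter> space (Pi\<^sub>M {1..} N) | A. A \<in> sets (Pi\<^sub>M {1..0::nat} N)}"
    unfolding filt_def by (rule sets_vimage_algebra2)
  also have "\<dots> = {{}, space (Pi\<^sub>M {1..} N)}"
  proof -
    have "sets (Pi\<^sub>M {1..0::nat} N) = {{}, {\<lambda>_. undefined}}"
      by (simp add: sets_PiM_empty)
    moreover have "(\<lambda>\<omega>. restrict \<omega> {1..0}) -` {\<lambda>_. undefined} = (UNIV :: (nat \<Rightarrow> 'a) set)"
      by (auto simp: restrict_def)
    moreover have "{f A | A. A \<in> {X, Y}} = {f X, f Y}"
      for f :: "(nat \<Rightarrow> 'a) set \<Rightarrow> (nat \<Rightarrow> 'a) set" and X Y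
      by blast
    ultimately show ?thesis
      by simp
  qed
  finally show ?thesis .
qed

lemma subalgebra_filt:
  assumes "sets P = sets (Pi\<^sub>M {1..} N)"
  shows "subalgebra P (filt N t)"
proof -
  have "(\<lambda>\<omega>. restrict \<omega> {1..t}) \<in> Pi\<^sub>M {1..} N \<rightarrow>\<^sub>M Pi\<^sub>M {1..t} N"
    by (rule measurable_restrict_subset) auto
  then have "sets (filt N t) \<subseteq> sets (Pi\<^sub>M {1..} N)"
    unfolding filt_def by (rule sets_image_in_sets[OF refl])
  moreover have "space P = space (Pi\<^sub>M {1..} N)"
    using assms by (rule sets_eq_imp_space_eq)
  ultimately show ?thesis
    using assms by (simp add: subalgebra_def filt_def)
qed

text \<open>
  Measurability into \<open>restrict_space borel {0..1}\<close> includes that the values lie in \<open>{0..1}\<close>. The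
  values of \<open>\<pi> 0\<close>, and of \<open>\<pi> t \<omega> p\<close> for \<open>p\<close> outside \<open>{0..1}\<close>, are irrelevant.
\<close>

definition updating_rule ::
  "(nat \<Rightarrow> 'a measure) \<Rightarrow> (nat \<Rightarrow> (nat \<Rightarrow> 'a) \<Rightarrow> real \<Rightarrow> real) \<Rightarrow> bool" where
  "updating_rule N \<pi> \<longleftrightarrow>
     (\<forall>t\<ge>1. (\<lambda>(\<omega>, p). \<pi> t \<omega> p) \<in>
        filt N t \<Otimes>\<^sub>M restrict_space borel {0..1} \<rightarrow>\<^sub>M restrict_space borel {0..1})"

text \<open>
  The inequality is required for random \<open>p\<close> known at time \<open>t\<close>; deterministic \<open>p\<close> are the
  constant functions.
\<close>

definition WBERHR ::
  "(nat \<Rightarrow> 'a measure) \<Rightarrow> (nat \<Rightarrow> 'a) measure \<Rightarrow> (nat \<Rightarrow> (nat \<Rightarrow> 'a) \<Rightarrow> real \<Rightarrow> real) \<Rightarrow>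
   (nat \<Rightarrow> (nat \<Rightarrow> 'a) \<Rightarrow> real) \<Rightarrow> bool" where
  "WBERHR N P \<pi> \<delta> \<longleftrightarrow>
     (\<forall>t. \<delta> t \<in> borel_measurable (filt N t) \<and> (AE \<omega> in P. 0 \<le> \<delta> t \<omega>)) \<and>
     (\<forall>t. \<forall>p \<in> filt N t \<rightarrow>\<^sub>M restrict_space borel {0..1}.
        AE \<omega> in P. real_cond_exp P (filt N t) (\<lambda>\<omega>. \<pi> (Suc t) \<omega> (p \<omega>)) \<omega> - p \<omega>
                     \<ge> \<delta> t \<omega> * p \<omega> * (1 - p \<omega>))"

definition BERHR ::
  "(nat \<Rightarrow> 'a measure) \<Rightarrow> (nat \<Rightarrow> 'a) measure \<Rightarrow> (nat \<Rightarrow> (nat \<Rightarrow> 'a) \<Rightarrow> real \<Rightarrow> real) \<Rightarrow> bool" where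
  "BERHR N P \<pi> \<longleftrightarrow> (\<exists>\<delta>. WBERHR N P \<pi> \<delta> \<and> (AE \<omega> in P. (INF t. \<delta> t \<omega>) > 0))"

definition compressing_sequence ::
  "(nat \<Rightarrow> 'a measure) \<Rightarrow> (nat \<Rightarrow> (nat \<Rightarrow> 'a) \<Rightarrow> real) \<Rightarrow> bool" where
  "compressing_sequence N \<theta> \<longleftrightarrow>
     (\<forall>t. \<theta> t \<in> filt N t \<rightarrow>\<^sub>M restrict_space borel {0<..1})"

definition small_step_rule ::
  "(nat \<Rightarrow> 'w \<Rightarrow> real) \<Rightarrow> (nat \<Rightarrow> 'w \<Rightarrow> real \<Rightarrow> real) \<Rightarrow> nat \<Rightarrow> 'w \<Rightarrow> real \<Rightarrow> real" where
  "small_step_rule \<theta> \<pi> t \<omega> p = p + \<theta> (t - 1) \<omega> * (\<pi> t \<omega> p - p)"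

primrec performance ::
  "(nat \<Rightarrow> 'w \<Rightarrow> real \<Rightarrow> real) \<Rightarrow> real \<Rightarrow> nat \<Rightarrow> 'w \<Rightarrow> real" where
  "performance \<pi> p0 0 \<omega> = p0"
| "performance \<pi> p0 (Suc t) \<omega> = \<pi> (Suc t) \<omega> (performance \<pi> p0 t \<omega>)"

definition harmonic_steps :: "nat \<Rightarrow> 'w \<Rightarrow> real" where
  "harmonic_steps t \<omega> = 1 / (real t + 2)"

lemma compressing_sequence_harmonic_steps: "compressing_sequence N harmonic_steps"
  by (auto simp: compressing_sequence_def harmonic_steps_def[abs_def] intro!: measurable_const)

end

theory Submission
  imports Defs
begin

text \<open>
  With \<open>\<theta> t = 1 / (t + 2)\<close> the process is an urn: \<open>S t = (t + 1) * P\<^sup>\<theta> t\<close> satisfies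
  \<open>S (t + 1) = S t + Y t\<close> with \<open>Y t \<in> [0,1]\<close> of conditional mean at least \<open>S t / (t + 1)\<close>.
  The digamma function is concave with \<open>\<psi> (s + 1) - \<psi> s = 1 / s\<close>, hence
  \<open>\<psi> (s + y) \<ge> \<psi> s + y / s\<close> for \<open>y \<in> [0,1]\<close>, and \<open>\<psi> (S t) - H\<^sub>t\<close> is a submartingale, \<open>H\<^sub>t\<close> being the
  harmonic numbers. As \<open>\<psi> \<le> ln\<close> and \<open>H\<^sub>t \<ge> ln (t + 1)\<close>, the expectation of \<open>- ln (P\<^sup>\<theta> t)\<close> is at most
  \<open>- \<psi> P\<^sub>0\<close> for every \<open>t\<close>, and Fatou's lemma excludes the limit 0.
  Finally, the sum of the expected increments is almost surely finite; since the step sizes have infinite sum and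
  the hazard rates are bounded away from 0, the limit \<open>x\<close> satisfies \<open>x * (1 - x) = 0\<close>.
\<close>

section \<open>Two inequalities for the digamma function, read off its limit formula\<close>

lemma Digamma_real_le_ln:
  fixes x :: real
  assumes "0 < x"
  shows "Digamma x \<le> ln x"
proof (rule LIMSEQ_le)
  show "(\<lambda>m. ln (real m) - (\<Sum>n<m. inverse (x + real n))) \<longlonglongrightarrow> Digamma x"
    using Digamma_LIMSEQ[of x] assms by simp
  show "(\<lambda>m. ln x) \<longlonglongrightarrow> ln x"
    by simp
  \<comment> \<open>Telescoping \<open>ln z \<le> z - 1\<close> over ratios of consecutive terms
    compares the sum with a logarithm; monotonicity of \<open>ln\<close> then absorbs the shift from
    \<open>m\<close> to \<open>x + m\<close>.\<close>
  have sum: "ln (x + real m) - ln x \<le> (\<Sum>n<m. inverse (x + real n))" for m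
  proof (induction m)
    case (Suc m)
    have "ln ((x + real (Suc m)) / (x + real m)) \<le> (x + real (Suc m)) / (x + real m) - 1"
      using assms by (intro ln_le_minus_one) (simp add: add_pos_nonneg)
    also have "\<dots> = inverse (x + real m)"
      using assms by (simp add: field_simps add_pos_nonneg)
    finally have "ln (x + real (Suc m)) - ln (x + real m) \<le> inverse (x + real m)"
      using assms by (simp add: ln_div add_pos_nonneg)
    with Suc show ?case
      by simp
  qed simp
  show "\<exists>N. \<forall>m\<ge>N. ln (real m) - (\<Sum>n<m. inverse (x + real n)) \<le> ln x"
  proof (intro exI allI impI)
    fix m :: nat assume "1 \<le> m"
    then have "ln (real m) \<le> ln (x + real m)"
      using assms by simp
    with sum[of m] show "ln (real m) - (\<Sum>n<m. inverse (x + real n)) \<le> ln x"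
      by linarith
  qed
qed

text \<open>Convexity of the reciprocal on \<open>[a, a + 1]\<close>, made explicit by a closed form
  of the gap. Summed term by term it yields concavity of \<open>Digamma\<close>.\<close>

lemma inverse_add_le_chord:
  fixes a y :: real
  assumes "0 < a" "0 \<le> y" "y \<le> 1"
  shows "inverse (a + y) \<le> (1 - y) * inverse a + y * inverse (a + 1)"
proof -
  have "(1 - y) * inverse a + y * inverse (a + 1) - inverse (a + y)
      = y * (1 - y) / (a * (a + 1) * (a + y))"
    using assms by (simp add: divide_simps) (simp add: algebra_simps)
  also have "\<dots> \<ge> 0"
    using assms by simp
  finally show ?thesis
    by simp
qed

text \<open>Concavity of the digamma function on \<open>[x, x + 1]\<close>, with the chord slope given by
  \<open>\<psi> (x + 1) - \<psi> x = 1 / x\<close>.\<close>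

lemma Digamma_add_ge:
  fixes x y :: real
  assumes "0 < x" "0 \<le> y" "y \<le> 1"
  shows "Digamma x + y / x \<le> Digamma (x + y)"
proof -
  let ?h = "\<lambda>z m. ln (real m) - (\<Sum>n<m. inverse (z + real n))"
  have lim: "?h z \<longlonglongrightarrow> Digamma z" if "0 < z" for z
    using Digamma_LIMSEQ[of z] that by simp
  have "(1 - y) * Digamma x + y * Digamma (x + 1) \<le> Digamma (x + y)"
  proof (rule LIMSEQ_le)
    show "(\<lambda>m. (1 - y) * ?h x m + y * ?h (x + 1) m)
        \<longlonglongrightarrow> (1 - y) * Digamma x + y * Digamma (x + 1)"
      using assms by (intro tendsto_intros lim) auto
    show "?h (x + y) \<longlonglongrightarrow> Digamma (x + y)"
      using assms by (intro lim) auto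
    \<comment> \<open>Concavity already holds before the limit: the weights \<open>1 - y\<close> and
      \<open>y\<close> add up to 1, so the terms \<open>ln m\<close> cancel and only the chord
      inequality for each summand remains.\<close>
    have "(1 - y) * ?h x m + y * ?h (x + 1) m \<le> ?h (x + y) m" for m
    proof -
      have "(\<Sum>n<m. inverse (x + y + real n))
          \<le> (\<Sum>n<m. (1 - y) * inverse (x + real n) + y * inverse (x + 1 + real n))"
      proof (rule sum_mono)
        fix n
        show "inverse (x + y + real n)
            \<le> (1 - y) * inverse (x + real n) + y * inverse (x + 1 + real n)"
          using inverse_add_le_chord[of "x + real n" y] assms by (simp add: add_ac)
      qed
      also have "\<dots> = (1 - y) * (\<Sum>n<m. inverse (x + real n)) + y * (\<Sum>n<m. inverse (x + 1 + real n))"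
        by (simp only: sum.distrib sum_distrib_left)
      finally have "ln (real m) - (\<Sum>n<m. inverse (x + y + real n)) \<ge> ln (real m)
          - ((1 - y) * (\<Sum>n<m. inverse (x + real n)) + y * (\<Sum>n<m. inverse (x + 1 + real n)))"
        by simp
      then show ?thesis
        by (simp only: left_diff_distrib right_diff_distrib)
    qed
    then show "\<exists>N. \<forall>m\<ge>N. (1 - y) * ?h x m + y * ?h (x + 1) m \<le> ?h (x + y) m"
      by blast
  qed
  moreover have "Digamma (x + 1) = Digamma x + 1 / x"
    using Digamma_plus1[of x] assms by simp
  ultimately show ?thesis
    using assms by (simp add: algebra_simps)
qed

text \<open>Exchanging sum and integral in \<open>ennreal\<close> bounds the integral of the whole
  series by \<open>B\<close>, so the series is finite almost everywhere.\<close>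

lemma AE_summable_of_bounded_integrals:
  fixes f :: "nat \<Rightarrow> 'b \<Rightarrow> real"
  assumes int: "\<And>n. integrable M (f n)"
    and nonneg: "\<And>n. AE \<omega> in M. 0 \<le> f n \<omega>"
    and bound: "\<And>n. (\<Sum>i<n. \<integral>\<omega>. f i \<omega> \<partial>M) \<le> B"
  shows "AE \<omega> in M. summable (\<lambda>n. f n \<omega>)"
proof -
  have [measurable]: "f n \<in> borel_measurable M" for n
    using int by auto
  have "(\<integral>\<^sup>+\<omega>. (\<Sum>n. ennreal (f n \<omega>)) \<partial>M) = (\<Sum>n. \<integral>\<^sup>+\<omega>. ennreal (f n \<omega>) \<partial>M)"
    by (rule nn_integral_suminf) simp
  also have "\<dots> = (\<Sum>n. ennreal (\<integral>\<omega>. f n \<omega> \<partial>M))"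
    using int nonneg by (simp add: nn_integral_eq_integral)
  also have "\<dots> \<le> ennreal B"
  proof (rule suminf_le_const)
    fix n
    show "(\<Sum>i<n. ennreal (\<integral>\<omega>. f i \<omega> \<partial>M)) \<le> ennreal B"
      using bound[of n] nonneg by (subst sum_ennreal) (auto intro: integral_nonneg_AE ennreal_leI)
  qed simp
  finally have "(\<integral>\<^sup>+\<omega>. (\<Sum>n. ennreal (f n \<omega>)) \<partial>M) \<noteq> \<infinity>"
    by (auto simp: top_unique)
  then have "AE \<omega> in M. (\<Sum>n. ennreal (f n \<omega>)) \<noteq> \<infinity>"
    by (intro nn_integral_PInf_AE) auto
  moreover have "AE \<omega> in M. \<forall>n. 0 \<le> f n \<omega>"
    using nonneg by (simp add: AE_all_countable)
  ultimately show ?thesis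
  proof eventually_elim
    case (elim \<omega>)
    then show ?case
      by (intro summable_suminf_not_top) auto
  qed
qed

text \<open>
  \<open>X\<close> is the proportion in a generalised urn of total content \<open>t + 1\<close> to which the amount
  \<open>Y t \<in> [0,1]\<close> is added in step \<open>t\<close>, and \<open>C t\<close> is a version of the conditional expectation of
  \<open>Y t\<close> given \<open>F t\<close> that has values in \<open>[0,1]\<close> everywhere.
\<close>

locale reinforced_urn = prob_space M for M :: "'b measure" +
  fixes F :: "nat \<Rightarrow> 'b measure" and X Y C :: "nat \<Rightarrow> 'b \<Rightarrow> real" and p0 :: real
  assumes subalg: "\<And>t. subalgebra M (F t)"
    and filtration: "\<And>s t. s \<le> t \<Longrightarrow> subalgebra (F t) (F s)"
    and X_measurable_F: "\<And>t. X t \<in> borel_measurable (F t)"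
    and Y_measurable_F: "\<And>t. Y t \<in> borel_measurable (F (Suc t))"
    and C_measurable_F: "\<And>t. C t \<in> borel_measurable (F t)"
    and Y_range: "\<And>t \<omega>. \<omega> \<in> space M \<Longrightarrow> Y t \<omega> \<in> {0..1}"
    and C_range: "\<And>t \<omega>. \<omega> \<in> space M \<Longrightarrow> C t \<omega> \<in> {0..1}"
    and p0: "0 < p0" "p0 \<le> 1"
    and X_0: "\<And>\<omega>. \<omega> \<in> space M \<Longrightarrow> X 0 \<omega> = p0"
    and X_Suc: "\<And>t \<omega>. \<omega> \<in> space M \<Longrightarrow> X (Suc t) \<omega> = X t \<omega> + (Y t \<omega> - X t \<omega>) / (real t + 2)"
    and integral_mult_Y: "\<And>t f B. f \<in> borel_measurable (F t) \<Longrightarrow>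
      (\<And>\<omega>. \<omega> \<in> space M \<Longrightarrow> \<bar>f \<omega>\<bar> \<le> B) \<Longrightarrow> (\<integral>\<omega>. f \<omega> * Y t \<omega> \<partial>M) = (\<integral>\<omega>. f \<omega> * C t \<omega> \<partial>M)"
    and drift_nonneg: "\<And>t. AE \<omega> in M. X t \<omega> \<le> C t \<omega>"
    and drift: "AE \<omega> in M. \<exists>d>0. \<forall>t. d * (X t \<omega> * (1 - X t \<omega>)) \<le> C t \<omega> - X t \<omega>"
begin

section \<open>Pointwise bounds for the proportions\<close>

lemma X_measurable [measurable]: "X t \<in> borel_measurable M"
  and Y_measurable [measurable]: "Y t \<in> borel_measurable M"
  and C_measurable [measurable]: "C t \<in> borel_measurable M"
  using measurable_from_subalg subalg X_measurable_F Y_measurable_F C_measurable_F by blast+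

lemma integrable_bounded:
  fixes f :: "'b \<Rightarrow> real"
  assumes "f \<in> borel_measurable M" "\<And>\<omega>. \<omega> \<in> space M \<Longrightarrow> \<bar>f \<omega>\<bar> \<le> B"
  shows "integrable M f"
  using assms by (intro integrable_const_bound[of _ B]) auto

text \<open>The content \<open>(t + 1) * X t\<close> starts at \<open>p0\<close>, never decreases
  and gains at most 1 per step. The lower bound, though vanishing in \<open>t\<close>, makes
  \<open>ln (X t)\<close> bounded for each fixed \<open>t\<close>.\<close>

lemma X_range:
  assumes "\<omega> \<in> space M"
  shows "p0 / (real t + 1) \<le> X t \<omega>" "0 < X t \<omega>" "X t \<omega> \<le> 1"
proof -
  have *: "p0 / (real t + 1) \<le> X t \<omega> \<and> X t \<omega> \<le> 1"
  proof (induction t)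
    case 0
    then show ?case
      using X_0[OF assms] p0 by simp
  next
    case (Suc t)
    have eq: "(real t + 2) * X (Suc t) \<omega> = (real t + 1) * X t \<omega> + Y t \<omega>"
      using X_Suc[OF assms, of t] by (simp add: field_simps)
    have "(real t + 1) * X t \<omega> \<ge> p0" "(real t + 1) * X t \<omega> \<le> real t + 1"
      using Suc mult_left_le[of "X t \<omega>" "real t + 1"] by (auto simp: field_simps)
    then have "p0 \<le> (real t + 2) * X (Suc t) \<omega>" "(real t + 2) * X (Suc t) \<omega> \<le> real t + 2"
      unfolding eq using Y_range[OF assms, of t] unfolding atLeastAtMost_iff by linarith+
    then have "p0 / (real t + 2) \<le> X (Suc t) \<omega>" "X (Suc t) \<omega> \<le> 1"
      using mult_le_cancel_left_pos[of "real t + 2" "X (Suc t) \<omega>" 1] by (auto simp: field_simps)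
    then show ?case
      by (simp add: add.commute)
  qed
  then show "p0 / (real t + 1) \<le> X t \<omega>" "X t \<omega> \<le> 1"
    by auto
  moreover have "0 < p0 / (real t + 1)"
    using p0 by simp
  ultimately show "0 < X t \<omega>"
    by linarith
qed

lemma X_abs_le: "\<omega> \<in> space M \<Longrightarrow> \<bar>X t \<omega>\<bar> \<le> 1"
  using X_range[of \<omega> t] by simp

lemma step_abs_le:
  assumes "\<omega> \<in> space M"
  shows "\<bar>X (Suc t) \<omega> - X t \<omega>\<bar> \<le> 1 / (real t + 2)"
  using X_range[OF assms, of t] Y_range[OF assms, of t]
  by (simp add: X_Suc[OF assms] abs_le_iff divide_right_mono)

section \<open>The digamma submartingale and the exclusion of the limit 0\<close>

definition S :: "nat \<Rightarrow> 'b \<Rightarrow> real" where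
  "S t \<omega> = (real t + 1) * X t \<omega>"

lemma S_range:
  assumes "\<omega> \<in> space M"
  shows "p0 \<le> S t \<omega>" "S t \<omega> \<le> real t + 1"
  using X_range[OF assms, of t] mult_left_le[of "X t \<omega>" "real t + 1"]
  by (auto simp: S_def field_simps)

lemma S_Suc: "\<omega> \<in> space M \<Longrightarrow> S (Suc t) \<omega> = S t \<omega> + Y t \<omega>"
  by (simp add: S_def X_Suc field_simps)

lemma Digamma_measurable [measurable]:
  "(\<lambda>\<omega>. Digamma (S t \<omega>)) \<in> borel_measurable M"
proof -
  have "continuous_on {0<..} (Digamma :: real \<Rightarrow> real)"
    by (rule continuous_on_Polygamma) (auto elim!: nonpos_Ints_cases)
  \<comment> \<open>\<open>Digamma\<close> is continuous only away from its poles; cutting it off to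
    the positive half-line changes nothing along \<open>S t\<close>, which stays above
    \<open>p0\<close>.\<close>
  then have "(\<lambda>x. indicator {0<..} x *\<^sub>R Digamma x :: real) \<in> borel_measurable borel"
    by (intro borel_measurable_continuous_on_indicator) auto
  then have "(\<lambda>\<omega>. indicator {0<..} (S t \<omega>) *\<^sub>R Digamma (S t \<omega>) :: real) \<in> borel_measurable M"
    unfolding S_def by measurable
  then show ?thesis
  proof (rule measurable_cong[THEN iffD1, rotated])
    fix \<omega> assume "\<omega> \<in> space M"
    then have "0 < S t \<omega>"
      using S_range[of \<omega> t] p0 by linarith
    then show "indicator {0<..} (S t \<omega>) *\<^sub>R Digamma (S t \<omega>) = (Digamma (S t \<omega>) :: real)"
      by simp
  qed
qed

lemma Digamma_integrable: "integrable M (\<lambda>\<omega>. Digamma (S t \<omega>))"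
proof (rule integrable_bounded)
  fix \<omega> assume \<omega>: "\<omega> \<in> space M"
  have "Digamma p0 \<le> Digamma (S t \<omega>)" "Digamma (S t \<omega>) \<le> Digamma (real t + 1)"
    using S_range[OF \<omega>, of t] p0 by (auto intro!: Digamma_real_mono)
  then show "\<bar>Digamma (S t \<omega>)\<bar> \<le> \<bar>Digamma p0\<bar> + \<bar>Digamma (real t + 1)\<bar>"
    by linarith
qed simp

text \<open>By concavity each step adds at least \<open>Y t / S t\<close>. Since
  \<open>1 / S t\<close> is bounded and known at time \<open>t\<close>, \<open>Y t\<close> may be
  replaced by \<open>C t\<close> under the integral, and \<open>S t \<le> (t + 1) * C t\<close>
  gives at least \<open>1 / (t + 1)\<close>, the next harmonic term.\<close>

lemma Digamma_expectation_ge: "Digamma p0 + harm t \<le> (\<integral>\<omega>. Digamma (S t \<omega>) \<partial>M)"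
proof (induction t)
  case 0
  have "(\<integral>\<omega>. Digamma (S 0 \<omega>) \<partial>M) = (\<integral>\<omega>. Digamma p0 \<partial>M)"
    by (intro Bochner_Integration.integral_cong) (auto simp: S_def X_0)
  then show ?case
    by (simp add: harm_def prob_space)
next
  case (Suc t)
  have inv: "\<bar>1 / S t \<omega>\<bar> \<le> 1 / p0" if "\<omega> \<in> space M" for \<omega>
    using S_range[OF that, of t] p0 by (simp add: frac_le)
  have SF: "(\<lambda>\<omega>. 1 / S t \<omega>) \<in> borel_measurable (F t)"
    unfolding S_def using X_measurable_F[of t] by measurable
  then have [measurable]: "(\<lambda>\<omega>. 1 / S t \<omega>) \<in> borel_measurable M"
    using measurable_from_subalg subalg by blast
  have int: "integrable M (\<lambda>\<omega>. 1 / S t \<omega> * Z \<omega>)"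
    if [measurable]: "Z \<in> borel_measurable M" and Z: "\<And>\<omega>. \<omega> \<in> space M \<Longrightarrow> Z \<omega> \<in> {0..1}" for Z
  proof (rule integrable_bounded)
    fix \<omega> assume \<omega>: "\<omega> \<in> space M"
    have "\<bar>1 / S t \<omega>\<bar> * \<bar>Z \<omega>\<bar> \<le> 1 / p0 * 1"
      using inv[OF \<omega>] Z[OF \<omega>] p0 by (intro mult_mono) auto
    then show "\<bar>1 / S t \<omega> * Z \<omega>\<bar> \<le> 1 / p0"
      by (simp add: abs_mult)
  qed measurable
  have "1 / (real t + 1) = (\<integral>\<omega>. 1 / (real t + 1) \<partial>M)"
    by (simp add: prob_space)
  also have "\<dots> \<le> (\<integral>\<omega>. 1 / S t \<omega> * C t \<omega> \<partial>M)"
  proof (rule integral_mono_AE)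
    show "integrable M (\<lambda>\<omega>. 1 / S t \<omega> * C t \<omega>)"
      by (intro int C_range) auto
    show "AE \<omega> in M. 1 / (real t + 1) \<le> 1 / S t \<omega> * C t \<omega>"
      using drift_nonneg[of t] AE_space
    proof eventually_elim
      case (elim \<omega>)
      have "0 < S t \<omega>"
        using S_range[OF elim(2), of t] p0 by linarith
      moreover have "S t \<omega> \<le> (real t + 1) * C t \<omega>"
        using elim by (simp add: S_def)
      ultimately show ?case
        by (simp add: field_simps)
    qed
  qed simp
  also have "\<dots> = (\<integral>\<omega>. 1 / S t \<omega> * Y t \<omega> \<partial>M)"
    using integral_mult_Y[OF SF inv] by simp
  finally have step: "1 / (real t + 1) \<le> (\<integral>\<omega>. 1 / S t \<omega> * Y t \<omega> \<partial>M)" .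
  have "Digamma p0 + harm (Suc t) \<le> (\<integral>\<omega>. Digamma (S t \<omega>) \<partial>M) + (\<integral>\<omega>. 1 / S t \<omega> * Y t \<omega> \<partial>M)"
    using Suc step by (simp add: harm_Suc inverse_eq_divide add.commute)
  also have "\<dots> = (\<integral>\<omega>. Digamma (S t \<omega>) + 1 / S t \<omega> * Y t \<omega> \<partial>M)"
    by (intro Bochner_Integration.integral_add[symmetric] Digamma_integrable int Y_range) auto
  also have "\<dots> \<le> (\<integral>\<omega>. Digamma (S (Suc t) \<omega>) \<partial>M)"
  proof (rule integral_mono)
    show "integrable M (\<lambda>\<omega>. Digamma (S t \<omega>) + 1 / S t \<omega> * Y t \<omega>)"
      by (intro Bochner_Integration.integrable_add Digamma_integrable int Y_range) auto
    fix \<omega> assume \<omega>: "\<omega> \<in> space M"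
    show "Digamma (S t \<omega>) + 1 / S t \<omega> * Y t \<omega> \<le> Digamma (S (Suc t) \<omega>)"
      using Digamma_add_ge[of "S t \<omega>" "Y t \<omega>"] S_range[OF \<omega>, of t] Y_range[OF \<omega>, of t] p0
      by (simp add: S_Suc[OF \<omega>])
  qed (rule Digamma_integrable)
  finally show ?case .
qed

lemma ln_integrable: "integrable M (\<lambda>\<omega>. ln (X t \<omega>))"
proof (rule integrable_bounded)
  fix \<omega> assume \<omega>: "\<omega> \<in> space M"
  have "ln (p0 / (real t + 1)) \<le> ln (X t \<omega>)" "ln (X t \<omega>) \<le> 0"
    using X_range[OF \<omega>, of t] p0 by auto
  then show "\<bar>ln (X t \<omega>)\<bar> \<le> \<bar>ln (p0 / (real t + 1))\<bar>"
    by linarith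
qed measurable

text \<open>Writing \<open>ln (S t)\<close> as \<open>ln (t + 1) + ln (X t)\<close> leaves a bound
  uniform in \<open>t\<close>, because the harmonic number dominates
  \<open>ln (t + 1)\<close>.\<close>

lemma ln_expectation_ge: "Digamma p0 \<le> (\<integral>\<omega>. ln (X t \<omega>) \<partial>M)"
proof -
  have "(\<integral>\<omega>. Digamma (S t \<omega>) \<partial>M) \<le> (\<integral>\<omega>. ln (real t + 1) + ln (X t \<omega>) \<partial>M)"
  proof (rule integral_mono)
    fix \<omega> assume \<omega>: "\<omega> \<in> space M"
    have "Digamma (S t \<omega>) \<le> ln (S t \<omega>)"
      using S_range[OF \<omega>, of t] p0 by (intro Digamma_real_le_ln) linarith
    then show "Digamma (S t \<omega>) \<le> ln (real t + 1) + ln (X t \<omega>)"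
      using X_range[OF \<omega>, of t] by (simp add: S_def ln_mult)
  qed (auto intro!: Digamma_integrable ln_integrable)
  also have "\<dots> = ln (real t + 1) + (\<integral>\<omega>. ln (X t \<omega>) \<partial>M)"
    by (simp add: ln_integrable prob_space)
  finally show ?thesis
    using Digamma_expectation_ge[of t] ln_le_harm[of t] by linarith
qed

text \<open>The variables \<open>- ln (X t)\<close> are nonnegative with bounded expectations, so by
  Fatou their lower limit is almost surely finite, whereas it would be infinite on a path tending to
  0.\<close>

lemma AE_not_tendsto_0: "AE \<omega> in M. \<not> (\<lambda>t. X t \<omega>) \<longlonglongrightarrow> 0"
proof -
  let ?u = "\<lambda>t \<omega>. ennreal (- ln (X t \<omega>))"
  have bound: "(\<integral>\<^sup>+\<omega>. ?u t \<omega> \<partial>M) \<le> ennreal (- Digamma p0)" for t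
  proof -
    have "(\<integral>\<^sup>+\<omega>. ?u t \<omega> \<partial>M) = ennreal (\<integral>\<omega>. - ln (X t \<omega>) \<partial>M)"
      using X_range[of _ t]
      by (intro nn_integral_eq_integral Bochner_Integration.integrable_minus ln_integrable AE_I2) auto
    then show ?thesis
      using ln_expectation_ge[of t] by (auto intro!: ennreal_leI)
  qed
  have "(\<integral>\<^sup>+\<omega>. liminf (\<lambda>t. ?u t \<omega>) \<partial>M) \<le> liminf (\<lambda>t. \<integral>\<^sup>+\<omega>. ?u t \<omega> \<partial>M)"
    by (rule nn_integral_liminf) measurable
  also have "\<dots> \<le> liminf (\<lambda>t::nat. ennreal (- Digamma p0))"
    by (intro Liminf_mono always_eventually allI bound)
  also have "\<dots> < \<infinity>"
    by (simp add: Liminf_const)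
  finally have "AE \<omega> in M. liminf (\<lambda>t. ?u t \<omega>) \<noteq> \<infinity>"
    by (intro nn_integral_PInf_AE) auto
  then show ?thesis
    using AE_space
  proof eventually_elim
    case (elim \<omega>)
    show ?case
    proof
      assume "(\<lambda>t. X t \<omega>) \<longlonglongrightarrow> 0"
      then have "filterlim (\<lambda>t. X t \<omega>) (at_right 0) sequentially"
        using X_range(2)[OF elim(2)] by (auto simp: filterlim_at less_imp_neq[symmetric])
      then have "filterlim (\<lambda>t. ln (X t \<omega>)) at_bot sequentially"
        by (rule filterlim_compose[OF ln_at_0])
      then have "filterlim (\<lambda>t. - ln (X t \<omega>)) at_top sequentially"
        by (simp add: filterlim_uminus_at_top)
      then have "(\<lambda>t. ?u t \<omega>) \<longlonglongrightarrow> \<infinity>"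
        by (simp add: ennreal_tendsto_top_eq_at_top)
      then have "liminf (\<lambda>t. ?u t \<omega>) = \<infinity>"
        by (intro lim_imp_Liminf) auto
      with elim show False
        by simp
    qed
  qed
qed

section \<open>Doob decomposition of the increments into martingale differences and predictable
  gains\<close>

definition noise :: "nat \<Rightarrow> 'b \<Rightarrow> real" where
  "noise t \<omega> = (Y t \<omega> - C t \<omega>) / (real t + 2)"

definition gain :: "nat \<Rightarrow> 'b \<Rightarrow> real" where
  "gain t \<omega> = (C t \<omega> - X t \<omega>) / (real t + 2)"

lemma noise_measurable [measurable]: "noise t \<in> borel_measurable M"
  and gain_measurable [measurable]: "gain t \<in> borel_measurable M"
  unfolding noise_def gain_def by measurable

lemma X_Suc_eq_noise_gain:
  "\<omega> \<in> space M \<Longrightarrow> X (Suc t) \<omega> = X t \<omega> + noise t \<omega> + gain t \<omega>"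
  by (simp add: X_Suc noise_def gain_def diff_divide_distrib)

lemma X_diff_eq_sum:
  assumes "\<omega> \<in> space M" "a \<le> b"
  shows "X b \<omega> - X a \<omega> = (\<Sum>t=a..<b. noise t \<omega>) + (\<Sum>t=a..<b. gain t \<omega>)"
  using assms(2) by (induction b rule: dec_induct) (simp_all add: X_Suc_eq_noise_gain[OF assms(1)])

lemma noise_abs_le:
  assumes "\<omega> \<in> space M"
  shows "\<bar>noise t \<omega>\<bar> \<le> 1 / (real t + 2)"
  using C_range[OF assms, of t] Y_range[OF assms, of t]
  by (simp add: noise_def abs_le_iff divide_right_mono)

lemma gain_abs_le:
  assumes "\<omega> \<in> space M"
  shows "\<bar>gain t \<omega>\<bar> \<le> 1 / (real t + 2)"
  using C_range[OF assms, of t] X_range[OF assms, of t]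
  by (simp add: gain_def abs_le_iff divide_right_mono)

lemma gain_nonneg: "AE \<omega> in M. 0 \<le> gain t \<omega>"
  using drift_nonneg[of t] by eventually_elim (simp add: gain_def)

lemma gain_integrable [simp]: "integrable M (gain t)"
  by (rule integrable_bounded[OF gain_measurable gain_abs_le])

lemma X_integrable [simp]: "integrable M (X t)"
  by (rule integrable_bounded[OF X_measurable X_abs_le])

lemma X_expectation_range: "(\<integral>\<omega>. X t \<omega> \<partial>M) \<in> {0..1}"
proof -
  have "0 \<le> (\<integral>\<omega>. X t \<omega> \<partial>M)"
    by (intro Bochner_Integration.integral_nonneg less_imp_le X_range)
  moreover have "(\<integral>\<omega>. X t \<omega> \<partial>M) \<le> (\<integral>\<omega>. 1 \<partial>M)"
    by (intro integral_mono X_range) auto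
  ultimately show ?thesis
    by (simp add: prob_space)
qed

text \<open>The martingale difference property in tested form. The choice \<open>f = 1\<close> gives
  mean zero, and earlier partial sums of the noise give vanishing cross terms.\<close>

lemma noise_orthogonal:
  assumes f: "f \<in> borel_measurable (F t)" and B: "\<And>\<omega>. \<omega> \<in> space M \<Longrightarrow> \<bar>f \<omega>\<bar> \<le> B"
  shows "(\<integral>\<omega>. f \<omega> * noise t \<omega> \<partial>M) = 0"
proof -
  have [measurable]: "f \<in> borel_measurable M"
    using f measurable_from_subalg subalg by blast
  have int: "integrable M (\<lambda>\<omega>. f \<omega> * Z \<omega>)"
    if [measurable]: "Z \<in> borel_measurable M" and Z: "\<And>\<omega>. \<omega> \<in> space M \<Longrightarrow> Z \<omega> \<in> {0..1}" for Z
  proof (rule integrable_bounded)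
    fix \<omega> assume \<omega>: "\<omega> \<in> space M"
    have "\<bar>f \<omega>\<bar> * \<bar>Z \<omega>\<bar> \<le> B * 1"
      using B[OF \<omega>] Z[OF \<omega>] by (intro mult_mono) auto
    then show "\<bar>f \<omega> * Z \<omega>\<bar> \<le> B"
      by (simp add: abs_mult)
  qed measurable
  have "(\<integral>\<omega>. f \<omega> * noise t \<omega> \<partial>M) = (\<integral>\<omega>. (f \<omega> * Y t \<omega> - f \<omega> * C t \<omega>) / (real t + 2) \<partial>M)"
    by (simp add: noise_def algebra_simps diff_divide_distrib)
  also have "\<dots> = ((\<integral>\<omega>. f \<omega> * Y t \<omega> \<partial>M) - (\<integral>\<omega>. f \<omega> * C t \<omega> \<partial>M)) / (real t + 2)"
    using Y_range C_range by (simp add: int)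
  also have "\<dots> = 0"
    using integral_mult_Y[OF f B] by simp
  finally show ?thesis .
qed

lemma sum_noise_abs_le:
  assumes "\<omega> \<in> space M"
  shows "\<bar>\<Sum>t=a..<b. noise t \<omega>\<bar> \<le> real (b - a)"
proof -
  have "\<bar>\<Sum>t=a..<b. noise t \<omega>\<bar> \<le> (\<Sum>t=a..<b. 1)"
  proof (rule order_trans[OF sum_abs sum_mono])
    fix t
    show "\<bar>noise t \<omega>\<bar> \<le> 1"
      by (rule order_trans[OF noise_abs_le[OF assms]]) simp
  qed
  then show ?thesis
    by simp
qed

lemma sum_noise_square_integrable: "integrable M (\<lambda>\<omega>. (\<Sum>t=a..<b. noise t \<omega>)\<^sup>2)"
proof (rule integrable_bounded)
  fix \<omega> assume "\<omega> \<in> space M"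
  then have "(\<Sum>t=a..<b. noise t \<omega>)\<^sup>2 \<le> (real (b - a))\<^sup>2"
    using sum_noise_abs_le by (intro abs_le_square_iff[THEN iffD1]) simp
  then show "\<bar>(\<Sum>t=a..<b. noise t \<omega>)\<^sup>2\<bar> \<le> (real (b - a))\<^sup>2"
    by simp
qed measurable

text \<open>Orthogonality makes the second moments add up, each being at most the squared step
  size.\<close>

lemma sum_noise_square_expectation_le:
  assumes "a \<le> b"
  shows "(\<integral>\<omega>. (\<Sum>t=a..<b. noise t \<omega>)\<^sup>2 \<partial>M) \<le> (\<Sum>t=a..<b. 1 / (real t + 2)\<^sup>2)"
  using assms
proof (induction b rule: dec_induct)
  case base
  then show ?case
    by simp
next
  case (step b)
  let ?T = "\<lambda>\<omega>. \<Sum>t=a..<b. noise t \<omega>"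
  \<comment> \<open>\<open>Y t\<close> is known only at time \<open>Suc t\<close>; the half-open
    range ensures \<open>Suc t \<le> b\<close>.\<close>
  have TF: "?T \<in> borel_measurable (F b)"
  proof (rule borel_measurable_sum)
    fix t assume "t \<in> {a..<b}"
    then have "subalgebra (F b) (F t)" "subalgebra (F b) (F (Suc t))"
      by (auto intro: filtration)
    then have [measurable]: "C t \<in> borel_measurable (F b)" "Y t \<in> borel_measurable (F b)"
      using measurable_from_subalg C_measurable_F Y_measurable_F by blast+
    show "noise t \<in> borel_measurable (F b)"
      unfolding noise_def by measurable
  qed
  have sq: "(noise b \<omega>)\<^sup>2 \<le> 1 / (real b + 2)\<^sup>2" if "\<omega> \<in> space M" for \<omega>
  proof -
    have "(noise b \<omega>)\<^sup>2 \<le> (1 / (real b + 2))\<^sup>2"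
      using noise_abs_le[OF that, of b] by (intro abs_le_square_iff[THEN iffD1]) simp
    then show ?thesis
      by (simp add: power_divide)
  qed
  have int1: "integrable M (\<lambda>\<omega>. (noise b \<omega>)\<^sup>2)"
    using sq by (intro integrable_bounded) auto
  have int2: "integrable M (\<lambda>\<omega>. ?T \<omega> * noise b \<omega>)"
  proof (rule integrable_bounded)
    fix \<omega> assume \<omega>: "\<omega> \<in> space M"
    show "\<bar>?T \<omega> * noise b \<omega>\<bar> \<le> real (b - a) * (1 / (real b + 2))"
      unfolding abs_mult using sum_noise_abs_le[OF \<omega>] noise_abs_le[OF \<omega>]
      by (intro mult_mono) auto
  qed measurable
  have "(\<integral>\<omega>. (\<Sum>t=a..<Suc b. noise t \<omega>)\<^sup>2 \<partial>M)
      = (\<integral>\<omega>. ((?T \<omega>)\<^sup>2 + 2 * (?T \<omega> * noise b \<omega>)) + (noise b \<omega>)\<^sup>2 \<partial>M)"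
    using step(1) by (simp add: power2_sum algebra_simps)
  also have "\<dots> = (\<integral>\<omega>. (?T \<omega>)\<^sup>2 \<partial>M) + 2 * (\<integral>\<omega>. ?T \<omega> * noise b \<omega> \<partial>M) + (\<integral>\<omega>. (noise b \<omega>)\<^sup>2 \<partial>M)"
    by (simp only: Bochner_Integration.integral_add Bochner_Integration.integrable_add
        integrable_mult_right integral_mult_right_zero int1 int2 sum_noise_square_integrable)
  also have "(\<integral>\<omega>. ?T \<omega> * noise b \<omega> \<partial>M) = 0"
    by (rule noise_orthogonal[OF TF sum_noise_abs_le])
  also have "(\<integral>\<omega>. (noise b \<omega>)\<^sup>2 \<partial>M) \<le> (\<integral>\<omega>. 1 / (real b + 2)\<^sup>2 \<partial>M)"
    using sq int1 by (intro integral_mono) auto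
  also have "\<dots> = 1 / (real b + 2)\<^sup>2"
    by (simp add: prob_space)
  finally show ?case
    using step by simp
qed

text \<open>The noise has mean zero, so each expected gain is a difference of consecutive
  expectations, and these telescope.\<close>

lemma sum_gain_expectation:
  assumes "a \<le> b"
  shows "(\<integral>\<omega>. (\<Sum>t=a..<b. gain t \<omega>) \<partial>M) = (\<integral>\<omega>. X b \<omega> \<partial>M) - (\<integral>\<omega>. X a \<omega> \<partial>M)"
proof -
  have "(\<integral>\<omega>. gain t \<omega> \<partial>M) = (\<integral>\<omega>. X (Suc t) \<omega> \<partial>M) - (\<integral>\<omega>. X t \<omega> \<partial>M)" for t
  proof -
    have int: "integrable M (noise t)"
      by (rule integrable_bounded[OF noise_measurable noise_abs_le])
    have "(\<integral>\<omega>. X (Suc t) \<omega> \<partial>M) = (\<integral>\<omega>. X t \<omega> + noise t \<omega> + gain t \<omega> \<partial>M)"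
      by (intro Bochner_Integration.integral_cong X_Suc_eq_noise_gain) auto
    also have "\<dots> = (\<integral>\<omega>. X t \<omega> \<partial>M) + (\<integral>\<omega>. noise t \<omega> \<partial>M) + (\<integral>\<omega>. gain t \<omega> \<partial>M)"
      using int by simp
    also have "(\<integral>\<omega>. noise t \<omega> \<partial>M) = 0"
      using noise_orthogonal[of "\<lambda>_. 1" t 1] by simp
    finally show ?thesis
      by simp
  qed
  then show ?thesis
    using assms sum_Suc_diff'[of a b "\<lambda>t. \<integral>\<omega>. X t \<omega> \<partial>M"] by simp
qed

lemma AE_summable_gain: "AE \<omega> in M. summable (\<lambda>t. gain t \<omega>)"
proof (rule AE_summable_of_bounded_integrals[OF gain_integrable gain_nonneg])
  fix n
  have "(\<Sum>t<n. \<integral>\<omega>. gain t \<omega> \<partial>M) = (\<integral>\<omega>. (\<Sum>t=0..<n. gain t \<omega>) \<partial>M)"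
    by (simp add: lessThan_atLeast0)
  also have "\<dots> = (\<integral>\<omega>. X n \<omega> \<partial>M) - (\<integral>\<omega>. X 0 \<omega> \<partial>M)"
    by (rule sum_gain_expectation) simp
  also have "\<dots> \<le> 1"
    using X_expectation_range[of 0] X_expectation_range[of n] by simp
  finally show "(\<Sum>t<n. \<integral>\<omega>. gain t \<omega> \<partial>M) \<le> 1" .
qed

text \<open>Almost sure convergence follows along the times \<open>k\<^sup>3\<close> without a maximal inequality: over the
  block from \<open>k\<^sup>3\<close> to \<open>(k + 1)\<^sup>3\<close> the noise has an \<open>L\<^sup>2\<close> norm of order \<open>k\<^sup>-\<^sup>2\<close>, which is summable, while
  the total step size of the block, of order \<open>1 / k\<close>, still tends to 0.\<close>

lemma cube_block_bounds:
  fixes k :: nat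
  shows "real ((Suc k)^3 - k^3) \<le> 3 * (real k + 1)\<^sup>2"
    and "k^3 \<le> t \<Longrightarrow> (real k + 1)^3 \<le> 4 * (real t + 2)"
proof -
  have "k ^ 3 \<le> (Suc k) ^ 3"
    by (rule power_mono) auto
  then show "real ((Suc k)^3 - k^3) \<le> 3 * (real k + 1)\<^sup>2"
    by (simp add: of_nat_diff power3_eq_cube power2_eq_square algebra_simps)
  \<comment> \<open>Expanded, this is \<open>4 * (k^3 + 1) - (k + 1)^3\<close>, slightly less than
    the difference wanted below.\<close>
  have "0 \<le> 3 * (real k - 1)\<^sup>2 * (real k + 1)"
    by simp
  then have "(real k + 1)^3 \<le> 4 * (real k ^ 3 + 2)"
    by (simp add: power3_eq_cube power2_eq_square algebra_simps)
  also assume "k^3 \<le> t"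
  then have "4 * (real k ^ 3 + 2) \<le> 4 * (real t + 2)"
    by (simp flip: of_nat_power)
  finally show "(real k + 1)^3 \<le> 4 * (real t + 2)" .
qed

text \<open>The gains are almost surely nonnegative, so their expected size telescopes. For the
  noise, at most \<open>3 * (k + 1)^2\<close> steps with second moment at most
  \<open>16 / (k + 1)^6\<close> each give \<open>48 / (k + 1)^4\<close>; passing from squares to
  absolute values with weight \<open>?c\<close> produces 48 + 1 = 49.\<close>

lemma cube_increment_expectation_le:
  "(\<integral>\<omega>. \<bar>X ((Suc k)^3) \<omega> - X (k^3) \<omega>\<bar> \<partial>M)
    \<le> 49 / (real k + 1)\<^sup>2 + ((\<integral>\<omega>. X ((Suc k)^3) \<omega> \<partial>M) - (\<integral>\<omega>. X (k^3) \<omega> \<partial>M))"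
proof -
  let ?a = "k^3" and ?b = "(Suc k)^3" and ?c = "(real k + 1)\<^sup>2"
  let ?T = "\<lambda>\<omega>. \<Sum>t=?a..<?b. noise t \<omega>" and ?G = "\<lambda>\<omega>. \<Sum>t=?a..<?b. gain t \<omega>"
  have ab: "?a \<le> ?b"
    by (rule power_mono) auto
  have c: "0 < ?c"
    by simp
  have "(\<Sum>t=?a..<?b. 1 / (real t + 2)\<^sup>2) \<le> (\<Sum>t=?a..<?b. 16 / (real k + 1)^6)"
  proof (rule sum_mono)
    fix t assume "t \<in> {?a..<?b}"
    then have "(real k + 1)^3 / 4 \<le> real t + 2"
      using cube_block_bounds(2)[of k t] by (intro mult_imp_div_pos_le) (simp_all add: mult.commute)
    then have "((real k + 1)^3 / 4)\<^sup>2 \<le> (real t + 2)\<^sup>2"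
      by (intro power_mono) auto
    then have "1 / (real t + 2)\<^sup>2 \<le> 1 / ((real k + 1)^3 / 4)\<^sup>2"
      by (intro frac_le) auto
    also have "\<dots> = 16 / (real k + 1)^6"
      by (simp add: power_divide flip: power_mult)
    finally show "1 / (real t + 2)\<^sup>2 \<le> 16 / (real k + 1)^6" .
  qed
  also have "\<dots> = real (?b - ?a) * (16 / (real k + 1)^6)"
    by simp
  also have "\<dots> \<le> (3 * ?c) * (16 / (real k + 1)^6)"
    using cube_block_bounds(1)[of k] by (rule mult_right_mono) simp
  also have "\<dots> = 48 / ?c\<^sup>2"
    by (simp add: divide_simps flip: power_mult power_add)
  finally have square: "(\<integral>\<omega>. (?T \<omega>)\<^sup>2 \<partial>M) \<le> 48 / ?c\<^sup>2"
    using sum_noise_square_expectation_le[OF ab] by linarith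
  have "(\<integral>\<omega>. \<bar>X ?b \<omega> - X ?a \<omega>\<bar> \<partial>M) \<le> (\<integral>\<omega>. (1 / ?c + ?c * (?T \<omega>)\<^sup>2) + ?G \<omega> \<partial>M)"
  proof (rule integral_mono_AE)
    have "AE \<omega> in M. \<forall>t. 0 \<le> gain t \<omega>"
      using gain_nonneg by (simp add: AE_all_countable)
    then show "AE \<omega> in M. \<bar>X ?b \<omega> - X ?a \<omega>\<bar> \<le> (1 / ?c + ?c * (?T \<omega>)\<^sup>2) + ?G \<omega>"
      using AE_space
    proof eventually_elim
      case (elim \<omega>)
      have "0 \<le> ?G \<omega>"
        using elim by (intro sum_nonneg) auto
      moreover have "\<bar>?T \<omega>\<bar> \<le> 1 / ?c + ?c * (?T \<omega>)\<^sup>2"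
      proof -
        \<comment> \<open>Completing the square in \<open>?c * \<bar>?T \<omega>\<bar>\<close>
          bounds the absolute value by the square without taking roots.\<close>
        have "0 \<le> (2 * ?c * \<bar>?T \<omega>\<bar> - 1)\<^sup>2 + 3"
          by simp
        also have "\<dots> = 4 * ?c * (1 / ?c + ?c * (?T \<omega>)\<^sup>2 - \<bar>?T \<omega>\<bar>)"
          using c by (simp add: power2_diff power_mult_distrib power2_eq_square[of ?c] algebra_simps)
        finally have "0 \<le> 1 / ?c + ?c * (?T \<omega>)\<^sup>2 - \<bar>?T \<omega>\<bar>"
          using c by (simp add: zero_le_mult_iff)
        then show ?thesis
          by simp
      qed
      ultimately show ?case
        unfolding X_diff_eq_sum[OF elim(2) ab] by linarith
    qed
  qed (auto intro!: Bochner_Integration.integrable_add integrable_mult_right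
        sum_noise_square_integrable Bochner_Integration.integrable_sum)
  also have "\<dots> = 1 / ?c + ?c * (\<integral>\<omega>. (?T \<omega>)\<^sup>2 \<partial>M) + (\<integral>\<omega>. ?G \<omega> \<partial>M)"
    by (subst Bochner_Integration.integral_add,
        (auto intro!: Bochner_Integration.integrable_add integrable_mult_right
          sum_noise_square_integrable Bochner_Integration.integrable_sum)[2])
      (simp add: sum_noise_square_integrable prob_space)
  also have "\<dots> \<le> 1 / ?c + ?c * (48 / ?c\<^sup>2) + (\<integral>\<omega>. ?G \<omega> \<partial>M)"
    using square by (intro add_mono mult_left_mono) auto
  also have "1 / ?c + ?c * (48 / ?c\<^sup>2) = 49 / ?c"
  proof -
    have "1 / x + x * (48 / x\<^sup>2) = 49 / x" if "0 < x" for x :: real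
      using that by (simp add: power2_eq_square)
    then show ?thesis
      using c .
  qed
  finally show ?thesis
    unfolding sum_gain_expectation[OF ab] .
qed

text \<open>In the bound for one block, the first part is a convergent series and the second
  telescopes to at most 1.\<close>

lemma AE_summable_cube_increments:
  "AE \<omega> in M. summable (\<lambda>k. \<bar>X ((Suc k)^3) \<omega> - X (k^3) \<omega>\<bar>)"
proof (rule AE_summable_of_bounded_integrals)
  have summ: "summable (\<lambda>k. 49 / (real k + 1)\<^sup>2)"
    using summable_mult[OF inverse_power_summable[of 2, where 'a = real, THEN summable_Suc_iff[THEN iffD2]], of 49]
    by (simp add: field_simps)
  fix n
  have "(\<Sum>k<n. \<integral>\<omega>. \<bar>X ((Suc k)^3) \<omega> - X (k^3) \<omega>\<bar> \<partial>M)
      \<le> (\<Sum>k<n. 49 / (real k + 1)\<^sup>2 + ((\<integral>\<omega>. X ((Suc k)^3) \<omega> \<partial>M) - (\<integral>\<omega>. X (k^3) \<omega> \<partial>M)))"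
    by (intro sum_mono cube_increment_expectation_le)
  also have "\<dots> = (\<Sum>k<n. 49 / (real k + 1)\<^sup>2) + ((\<integral>\<omega>. X (n^3) \<omega> \<partial>M) - (\<integral>\<omega>. X (0^3) \<omega> \<partial>M))"
    using sum_lessThan_telescope[of "\<lambda>k. \<integral>\<omega>. X (k^3) \<omega> \<partial>M" n] by (simp add: sum.distrib)
  also have "\<dots> \<le> (\<Sum>k. 49 / (real k + 1)\<^sup>2) + (1 - 0)"
    using X_expectation_range by (intro add_mono diff_mono sum_le_suminf summ) auto
  finally show "(\<Sum>k<n. \<integral>\<omega>. \<bar>X ((Suc k)^3) \<omega> - X (k^3) \<omega>\<bar> \<partial>M)
      \<le> (\<Sum>k. 49 / (real k + 1)\<^sup>2) + 1"
    by simp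
qed auto

text \<open>Only step sizes enter: at most \<open>3 * (k + 1)^2\<close> steps, each of size at most
  \<open>4 / (k + 1)^3\<close>.\<close>

lemma block_oscillation_le:
  assumes "\<omega> \<in> space M" "k^3 \<le> t" "t \<le> (Suc k)^3"
  shows "\<bar>X t \<omega> - X (k^3) \<omega>\<bar> \<le> 12 / (real k + 1)"
proof -
  let ?q = "4 / (real k + 1)^3"
  have osc: "\<bar>X t \<omega> - X (k^3) \<omega>\<bar> \<le> real (t - k^3) * ?q" if "k^3 \<le> t" for t
    using that
  proof (induction t rule: dec_induct)
    case base
    then show ?case
      by simp
  next
    case (step t)
    have "(real k + 1)^3 \<le> 4 * (real t + 2)"
      using step(1) by (rule cube_block_bounds(2))
    then have "1 / (real t + 2) \<le> ?q"
      by (simp add: field_simps)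
    then have "\<bar>X (Suc t) \<omega> - X (k^3) \<omega>\<bar> \<le> real (t - k^3) * ?q + ?q"
      using step_abs_le[OF assms(1), of t] step(3) by linarith
    also have "\<dots> = (real (t - k^3) + 1) * ?q"
      by (simp only: distrib_right mult_1)
    also have "real (t - k^3) + 1 = real (Suc t - k^3)"
      using step(1) by (simp add: Suc_diff_le)
    finally show ?case .
  qed
  have "real (t - k^3) \<le> real ((Suc k)^3 - k^3)"
    using assms by (intro of_nat_mono diff_le_mono)
  also have "\<dots> \<le> 3 * (real k + 1)\<^sup>2"
    by (rule cube_block_bounds(1))
  finally have "real (t - k^3) * ?q \<le> 3 * (real k + 1)\<^sup>2 * ?q"
    by (rule mult_right_mono) simp
  also have "\<dots> = 12 / (real k + 1)"
    by (simp add: power3_eq_cube power2_eq_square)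
  finally show ?thesis
    using osc[OF assms(2)] by linarith
qed

text \<open>Absolutely summable increments give a limit along the cubes, and the vanishing
  oscillation within blocks extends it to all times.\<close>

lemma AE_convergent: "AE \<omega> in M. convergent (\<lambda>t. X t \<omega>)"
  using AE_summable_cube_increments AE_space
proof eventually_elim
  case (elim \<omega>)
  have "convergent (\<lambda>n. \<Sum>k<n. X ((Suc k)^3) \<omega> - X (k^3) \<omega>)"
    using summable_rabs_cancel[OF elim(1)] by (simp add: summable_iff_convergent)
  then have "convergent (\<lambda>n. X (n^3) \<omega> - X (0^3) \<omega>)"
    by (simp only: sum_lessThan_telescope[of "\<lambda>k. X (k^3) \<omega>"])
  then have "convergent (\<lambda>n. X (n^3) \<omega>)"
    using convergent_add[OF _ convergent_const[of "X (0^3) \<omega>"]] by fastforce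
  then obtain L where L: "(\<lambda>n. X (n^3) \<omega>) \<longlonglongrightarrow> L"
    by (auto simp: convergent_def)
  have "(\<lambda>t. X t \<omega>) \<longlonglongrightarrow> L"
  proof (rule LIMSEQ_I)
    fix r :: real assume r: "0 < r"
    have "(\<lambda>k. 12 / (real k + 1)) \<longlonglongrightarrow> 0"
      using LIMSEQ_Suc[OF lim_const_over_n[of 12]] by (simp add: add.commute)
    then have "\<forall>\<^sub>F k in sequentially. 12 / (real k + 1) < r / 2"
      by (rule order_tendstoD(2)) (use r in simp)
    moreover have "\<forall>\<^sub>F k in sequentially. \<bar>X (k^3) \<omega> - L\<bar> < r / 2"
      using tendstoD[OF L, of "r / 2"] r by (simp add: dist_real_def)
    ultimately have "\<forall>\<^sub>F k in sequentially. 12 / (real k + 1) < r / 2 \<and> \<bar>X (k^3) \<omega> - L\<bar> < r / 2"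
      by eventually_elim simp
    then obtain K where K: "\<And>k. K \<le> k \<Longrightarrow> 12 / (real k + 1) < r / 2 \<and> \<bar>X (k^3) \<omega> - L\<bar> < r / 2"
      by (auto simp: eventually_sequentially)
    have "norm (X t \<omega> - L) < r" if t: "K^3 \<le> t" for t
    proof -
      \<comment> \<open>Induction on \<open>t\<close> locates the block containing \<open>t\<close>:
        the index \<open>k\<close> is kept until the right end is reached, then raised by
        one.\<close>
      have "\<exists>k\<ge>K. k^3 \<le> t \<and> t \<le> (Suc k)^3"
        using t
      proof (induction t rule: dec_induct)
        case base
        have "K^3 \<le> (Suc K)^3"
          by (rule power_mono) auto
        then show ?case
          by blast
      next
        case (step t)
        then obtain k where k: "K \<le> k" "k^3 \<le> t" "t \<le> (Suc k)^3"
          by blast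
        show ?case
        proof (cases "t = (Suc k)^3")
          case True
          have "(Suc k)^3 < (Suc (Suc k))^3"
            by (rule power_strict_mono) auto
          with k True show ?thesis
            by (intro exI[of _ "Suc k"]) simp
        next
          case False
          with k show ?thesis
            by (intro exI[of _ k]) simp
        qed
      qed
      then obtain k where "K \<le> k" "k^3 \<le> t" "t \<le> (Suc k)^3"
        by blast
      then show ?thesis
        using block_oscillation_le[OF elim(2), of k t] K[of k] unfolding real_norm_def by linarith
    qed
    then show "\<exists>no. \<forall>n\<ge>no. norm (X n \<omega> - L) < r"
      by blast
  qed
  then show ?case
    by (auto simp: convergent_def)
qed

text \<open>At a limit strictly between 0 and 1 the product \<open>X t * (1 - X t)\<close> would
  stay above some \<open>c > 0\<close> eventually, so the gains would dominate a multiple of the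
  harmonic series, although they are summable.\<close>

lemma AE_tendsto_1: "AE \<omega> in M. (\<lambda>t. X t \<omega>) \<longlonglongrightarrow> 1"
  using AE_convergent AE_not_tendsto_0 AE_summable_gain drift AE_space
proof eventually_elim
  case (elim \<omega>)
  from elim(1) obtain L where L: "(\<lambda>t. X t \<omega>) \<longlonglongrightarrow> L"
    by (auto simp: convergent_def)
  from elim(4) obtain d where d: "0 < d" "\<And>t. d * (X t \<omega> * (1 - X t \<omega>)) \<le> C t \<omega> - X t \<omega>"
    by blast
  have "0 \<le> L" "L \<le> 1"
    using LIMSEQ_le_const[OF L, of 0] LIMSEQ_le_const2[OF L, of 1] X_range[OF elim(5)]
    by (auto simp: less_imp_le)
  moreover have "L \<noteq> 0"
    using elim(2) L by blast
  moreover have "\<not> (0 < L \<and> L < 1)"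
  proof
    assume "0 < L \<and> L < 1"
    then have pos: "0 < L * (1 - L)"
      by simp
    define c where "c = L * (1 - L) / 2"
    have c: "0 < c" "c < L * (1 - L)"
      using pos by (auto simp: c_def)
    have "(\<lambda>t. X t \<omega> * (1 - X t \<omega>)) \<longlonglongrightarrow> L * (1 - L)"
      by (intro tendsto_intros L)
    then have ev: "\<forall>\<^sub>F t in sequentially. c < X t \<omega> * (1 - X t \<omega>)"
      using c by (intro order_tendstoD(1))
    have "summable (\<lambda>t. d * c * inverse (real (t + 2)))"
    proof (rule summable_comparison_test_ev[OF _ elim(3)])
      show "\<forall>\<^sub>F t in sequentially. norm (d * c * inverse (real (t + 2))) \<le> gain t \<omega>"
        using ev
      proof eventually_elim
        case (elim t)
        have "d * c \<le> d * (X t \<omega> * (1 - X t \<omega>))"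
          using elim d by (intro mult_left_mono) auto
        also note d(2)
        finally have "d * c / (real t + 2) \<le> gain t \<omega>"
          unfolding gain_def by (rule divide_right_mono) simp
        then show ?case
          using c d by (simp add: divide_inverse abs_mult add.commute)
      qed
    qed
    then have "summable (\<lambda>t. inverse (real (t + 2)))"
      using c d by (simp add: summable_cmult_iff)
    then have "summable (\<lambda>t. inverse (real t))"
      by (rule summable_iff_shift[THEN iffD1])
    then show False
      using not_summable_harmonic[where 'a = real] by simp
  qed
  ultimately have "L = 1"
    by argo
  then show ?case
    using L by simp
qed

end

section \<open>The small step-size process as a reinforced urn\<close>

lemma space_filt [simp]: "space (filt N t) = space (Pi\<^sub>M {1..} N)"
  by (simp add: filt_def)

text \<open>Restriction to the first \<open>s\<close> coordinates factors through restriction to the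
  first \<open>t\<close>.\<close>

lemma subalgebra_filt_mono:
  assumes "s \<le> t"
  shows "subalgebra (filt N t) (filt N s)"
proof -
  let ?\<Omega> = "space (Pi\<^sub>M {1..} N)"
  have maps: "(\<lambda>\<omega>. restrict \<omega> {1..t}) \<in> ?\<Omega> \<rightarrow> space (Pi\<^sub>M {1..t} N)"
    by (auto simp: space_PiM)
  have "(\<lambda>\<omega>. restrict \<omega> {1..t}) \<in> filt N t \<rightarrow>\<^sub>M Pi\<^sub>M {1..t} N"
    unfolding filt_def using maps by (rule measurable_vimage_algebra1)
  then have "(\<lambda>\<omega>. restrict (restrict \<omega> {1..t}) {1..s}) \<in> filt N t \<rightarrow>\<^sub>M Pi\<^sub>M {1..s} N"
    by (rule measurable_compose) (rule measurable_restrict_subset, use assms in auto)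
  moreover have "{1..t} \<inter> {1..s} = {1..s}"
    using assms by auto
  ultimately have "(\<lambda>\<omega>. restrict \<omega> {1..s}) \<in> filt N t \<rightarrow>\<^sub>M Pi\<^sub>M {1..s} N"
    by (simp only: restrict_restrict)
  then have "sets (filt N s) \<subseteq> sets (filt N t)"
    unfolding filt_def[of N s] by (intro sets_image_in_sets) auto
  then show ?thesis
    by (simp add: subalgebra_def)
qed

lemma performance_small_step_measurable:
  assumes upd: "updating_rule N \<pi>" and p0: "p0 \<in> {0..1}"
  shows "performance (small_step_rule harmonic_steps \<pi>) p0 t
    \<in> filt N t \<rightarrow>\<^sub>M restrict_space borel {0..1}"
    and "(\<lambda>\<omega>. \<pi> (Suc t) \<omega> (performance (small_step_rule harmonic_steps \<pi>) p0 t \<omega>))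
    \<in> filt N (Suc t) \<rightarrow>\<^sub>M restrict_space borel {0..1}"
proof -
  let ?X = "performance (small_step_rule harmonic_steps \<pi>) p0"
  have Y: "(\<lambda>\<omega>. \<pi> (Suc t) \<omega> (?X t \<omega>)) \<in> filt N (Suc t) \<rightarrow>\<^sub>M restrict_space borel {0..1}"
    if "?X t \<in> filt N t \<rightarrow>\<^sub>M restrict_space borel {0..1}" for t
  proof -
    have "?X t \<in> filt N (Suc t) \<rightarrow>\<^sub>M restrict_space borel {0..1}"
      using measurable_from_subalg[OF subalgebra_filt_mono that] by simp
    moreover have "(\<lambda>(\<omega>, p). \<pi> (Suc t) \<omega> p) \<in>
        filt N (Suc t) \<Otimes>\<^sub>M restrict_space borel {0..1} \<rightarrow>\<^sub>M restrict_space borel {0..1}"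
      using upd by (simp add: updating_rule_def)
    ultimately show ?thesis
      \<comment> \<open>Joint measurability of the rule is used here, composed with the map sending
        \<open>\<omega>\<close> to the pair of \<open>\<omega>\<close> and the current
        value.\<close>
      using measurable_compose[OF measurable_Pair[OF measurable_ident]] by fastforce
  qed
  show X: "?X t \<in> filt N t \<rightarrow>\<^sub>M restrict_space borel {0..1}" for t
  proof (induction t)
    case 0
    then show ?case
      using p0 by (auto intro!: measurable_const)
  next
    case (Suc t)
    have meas: "?X t \<in> borel_measurable (filt N (Suc t))"
      "(\<lambda>\<omega>. \<pi> (Suc t) \<omega> (?X t \<omega>)) \<in> borel_measurable (filt N (Suc t))"
      using measurable_from_subalg[OF subalgebra_filt_mono, of t "Suc t"] Suc Y[OF Suc]
      by (auto simp: measurable_restrict_space2_iff)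
    show ?case
    proof (rule measurable_restrict_space2)
      have "?X (Suc t) = (\<lambda>\<omega>. ?X t \<omega> + 1 / (real t + 2) * (\<pi> (Suc t) \<omega> (?X t \<omega>) - ?X t \<omega>))"
        by (rule ext) (simp add: small_step_rule_def harmonic_steps_def)
      then show "?X (Suc t) \<in> borel_measurable (filt N (Suc t))"
        using meas by simp
      show "?X (Suc t) \<in> space (filt N (Suc t)) \<rightarrow> {0..1}"
      proof
        fix \<omega> assume "\<omega> \<in> space (filt N (Suc t))"
        then have range: "?X t \<omega> \<in> {0..1}" "\<pi> (Suc t) \<omega> (?X t \<omega>) \<in> {0..1}"
          using Suc Y[OF Suc] by (auto simp: measurable_restrict_space2_iff)
        \<comment> \<open>The new value is a convex combination with weights
          \<open>(t + 1) / (t + 2)\<close> and \<open>1 / (t + 2)\<close>.\<close>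
        have "?X (Suc t) \<omega>
            = ((real t + 1) * ?X t \<omega> + \<pi> (Suc t) \<omega> (?X t \<omega>)) / (real t + 2)"
          by (simp add: small_step_rule_def harmonic_steps_def field_simps)
        moreover have "(real t + 1) * ?X t \<omega> \<le> real t + 1"
          using range by (intro mult_left_le) auto
        then have "(real t + 1) * ?X t \<omega> + \<pi> (Suc t) \<omega> (?X t \<omega>) \<le> real t + 2"
          using range unfolding atLeastAtMost_iff by linarith
        ultimately show "?X (Suc t) \<omega> \<in> {0..1}"
          using range by (simp add: divide_le_eq)
      qed
    qed
  qed
  show "(\<lambda>\<omega>. \<pi> (Suc t) \<omega> (?X t \<omega>)) \<in> filt N (Suc t) \<rightarrow>\<^sub>M restrict_space borel {0..1}"
    by (rule Y[OF X])
qed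

theorem corollary2p1:
  fixes N :: "nat \<Rightarrow> 'a measure"
    and P :: "(nat \<Rightarrow> 'a) measure"
    and \<pi> :: "nat \<Rightarrow> (nat \<Rightarrow> 'a) \<Rightarrow> real \<Rightarrow> real"
    and P0 :: real
  assumes "prob_space P"
    and "sets P = sets (Pi\<^sub>M {1..} N)"
    and "updating_rule N \<pi>"
    and "BERHR N P \<pi>"
    and "0 < P0" and "P0 \<le> 1"
  defines "P\<theta> \<equiv> performance (small_step_rule harmonic_steps \<pi>) P0"
  shows "(AE \<omega> in P. convergent (\<lambda>t. P\<theta> t \<omega>)) \<and>
         measure P {\<omega> \<in> space P. lim (\<lambda>t. P\<theta> t \<omega>) = 1} = 1"
proof -
  interpret prob_space P by fact
  have sub: "subalgebra P (filt N t)" for t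
    using assms(2) by (rule subalgebra_filt)
  have space: "space P = space (Pi\<^sub>M {1..} N)"
    using assms(2) by (rule sets_eq_imp_space_eq)
  obtain \<delta> where \<delta>: "WBERHR N P \<pi> \<delta>" "AE \<omega> in P. 0 < (INF t. \<delta> t \<omega>)"
    using assms(4) by (auto simp: BERHR_def)
  define Y where "Y t \<omega> = \<pi> (Suc t) \<omega> (P\<theta> t \<omega>)" for t \<omega>
  \<comment> \<open>\<open>real_cond_exp\<close> is within \<open>[0,1]\<close> only almost surely;
    clamping gives a version for which this holds at every point.\<close>
  define C where "C t \<omega> = max 0 (min 1 (real_cond_exp P (filt N t) (Y t) \<omega>))" for t \<omega>
  have p0: "P0 \<in> {0..1}"
    using assms by simp
  have X: "P\<theta> t \<in> filt N t \<rightarrow>\<^sub>M restrict_space borel {0..1}" for t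
    unfolding P\<theta>_def using assms(3) p0 by (rule performance_small_step_measurable)
  have Y: "Y t \<in> filt N (Suc t) \<rightarrow>\<^sub>M restrict_space borel {0..1}" for t
    unfolding Y_def[abs_def] P\<theta>_def using assms(3) p0 by (rule performance_small_step_measurable)
  have X_borel: "P\<theta> t \<in> borel_measurable (filt N t)"
    and X_01: "\<And>\<omega>. \<omega> \<in> space P \<Longrightarrow> P\<theta> t \<omega> \<in> {0..1}"
    and Y_borel: "Y t \<in> borel_measurable (filt N (Suc t))"
    and Y_01: "\<And>\<omega>. \<omega> \<in> space P \<Longrightarrow> Y t \<omega> \<in> {0..1}" for t
    using X[of t] Y[of t] by (auto simp: measurable_restrict_space2_iff space)
  have [measurable]: "Y t \<in> borel_measurable P" "P\<theta> t \<in> borel_measurable P" for t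
    using measurable_from_subalg[OF sub] X_borel Y_borel by blast+
  have int: "integrable P (\<lambda>\<omega>. f \<omega> * Y t \<omega>)"
    if [measurable]: "f \<in> borel_measurable P" and B: "\<And>\<omega>. \<omega> \<in> space P \<Longrightarrow> \<bar>f \<omega>\<bar> \<le> B" for f B t
  proof (rule integrable_const_bound[of _ B])
    show "AE \<omega> in P. norm (f \<omega> * Y t \<omega>) \<le> B"
    proof (rule AE_I2)
      fix \<omega> assume \<omega>: "\<omega> \<in> space P"
      have "\<bar>f \<omega>\<bar> * \<bar>Y t \<omega>\<bar> \<le> B * 1"
        using B[OF \<omega>] Y_01[OF \<omega>, of t] by (intro mult_mono) auto
      then show "norm (f \<omega> * Y t \<omega>) \<le> B"
        by (simp add: abs_mult)
    qed
  qed measurable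
  have sf: "sigma_finite_subalgebra P (filt N t)" for t
    by (intro finite_measure_subalgebra_is_sigma_finite finite_measure_subalgebra.intro
        finite_measure_subalgebra_axioms.intro sub) unfold_locales
  have C_eq: "AE \<omega> in P. C t \<omega> = real_cond_exp P (filt N t) (Y t) \<omega>" for t
  proof -
    interpret sigma_finite_subalgebra P "filt N t" by (rule sf)
    have intY: "integrable P (Y t)"
      using int[of "\<lambda>_. 1" 1 t] by simp
    have "AE \<omega> in P. 0 \<le> real_cond_exp P (filt N t) (Y t) \<omega>"
      using Y_01 by (intro real_cond_exp_ge_c[OF intY]) auto
    moreover have "AE \<omega> in P. real_cond_exp P (filt N t) (Y t) \<omega> \<le> 1"
      using Y_01 by (intro real_cond_exp_le_c[OF intY]) auto
    ultimately show ?thesis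
      by eventually_elim (simp add: C_def)
  qed
  \<comment> \<open>WBERHR is applied to the random argument \<open>P\<theta> t\<close>; as the
    times are countable, one null set serves them all.\<close>
  have drift: "AE \<omega> in P. \<forall>t. 0 \<le> \<delta> t \<omega> \<and> \<delta> t \<omega> * (P\<theta> t \<omega> * (1 - P\<theta> t \<omega>)) \<le> C t \<omega> - P\<theta> t \<omega>"
    unfolding AE_all_countable
  proof
    fix t
    have "AE \<omega> in P. 0 \<le> \<delta> t \<omega>"
      "AE \<omega> in P. real_cond_exp P (filt N t) (Y t) \<omega> - P\<theta> t \<omega> \<ge> \<delta> t \<omega> * P\<theta> t \<omega> * (1 - P\<theta> t \<omega>)"
      using \<delta>(1) X[of t] by (auto simp: WBERHR_def Y_def[abs_def])
    then show "AE \<omega> in P. 0 \<le> \<delta> t \<omega> \<and> \<delta> t \<omega> * (P\<theta> t \<omega> * (1 - P\<theta> t \<omega>)) \<le> C t \<omega> - P\<theta> t \<omega>"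
      using C_eq[of t] by eventually_elim (simp add: mult.assoc)
  qed
  interpret reinforced_urn P "filt N" P\<theta> Y C P0
  proof unfold_locales
    show "subalgebra P (filt N t)" for t
      by (rule sub)
    show "subalgebra (filt N t) (filt N s)" if "s \<le> t" for s t
      using that by (rule subalgebra_filt_mono)
    show "C t \<in> borel_measurable (filt N t)" for t
      unfolding C_def[abs_def] by measurable
    show "P\<theta> t \<in> borel_measurable (filt N t)" "Y t \<in> borel_measurable (filt N (Suc t))" for t
      by (rule X_borel Y_borel)+
    show "Y t \<omega> \<in> {0..1}" if "\<omega> \<in> space P" for t \<omega>
      using that by (rule Y_01)
    show "C t \<omega> \<in> {0..1}" for t \<omega>
      by (simp add: C_def)
    show "0 < P0" "P0 \<le> 1"
      by fact+
    show "P\<theta> 0 \<omega> = P0" for \<omega>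
      by (simp add: P\<theta>_def)
    show "P\<theta> (Suc t) \<omega> = P\<theta> t \<omega> + (Y t \<omega> - P\<theta> t \<omega>) / (real t + 2)" for t \<omega>
      by (simp add: P\<theta>_def Y_def small_step_rule_def harmonic_steps_def)
    show "(\<integral>\<omega>. f \<omega> * Y t \<omega> \<partial>P) = (\<integral>\<omega>. f \<omega> * C t \<omega> \<partial>P)"
      if f: "f \<in> borel_measurable (filt N t)" and B: "\<And>\<omega>. \<omega> \<in> space P \<Longrightarrow> \<bar>f \<omega>\<bar> \<le> B" for t f B
    proof -
      interpret sigma_finite_subalgebra P "filt N t" by (rule sf)
      have [measurable]: "f \<in> borel_measurable P"
        using measurable_from_subalg[OF sub] f by blast
      have [measurable]: "C t \<in> borel_measurable P"
        unfolding C_def[abs_def] by measurable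
      have "(\<integral>\<omega>. f \<omega> * Y t \<omega> \<partial>P) = (\<integral>\<omega>. f \<omega> * real_cond_exp P (filt N t) (Y t) \<omega> \<partial>P)"
        using B by (intro real_cond_exp_intg(2)[symmetric] int f) auto
      also have "\<dots> = (\<integral>\<omega>. f \<omega> * C t \<omega> \<partial>P)"
        using C_eq[of t] by (intro integral_cong_AE) auto
      finally show ?thesis .
    qed
    show "AE \<omega> in P. P\<theta> t \<omega> \<le> C t \<omega>" for t
      using drift AE_space
    proof eventually_elim
      case (elim \<omega>)
      have "0 \<le> \<delta> t \<omega> * (P\<theta> t \<omega> * (1 - P\<theta> t \<omega>))"
        using elim(1) X_01[OF elim(2), of t] by simp
      also have "\<dots> \<le> C t \<omega> - P\<theta> t \<omega>"
        using elim(1) by blast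
      finally show ?case
        by simp
    qed
    show "AE \<omega> in P. \<exists>d>0. \<forall>t. d * (P\<theta> t \<omega> * (1 - P\<theta> t \<omega>)) \<le> C t \<omega> - P\<theta> t \<omega>"
      using drift \<delta>(2) AE_space
    proof eventually_elim
      case (elim \<omega>)
      have "(INF t. \<delta> t \<omega>) * (P\<theta> t \<omega> * (1 - P\<theta> t \<omega>)) \<le> C t \<omega> - P\<theta> t \<omega>" for t
      proof -
        \<comment> \<open>A real \<open>INF\<close> is a lower bound only for a family bounded
          below, which nonnegativity of \<open>\<delta>\<close> provides. The constant
          \<open>d\<close> is this infimum and depends on the path.\<close>
        have "(INF t. \<delta> t \<omega>) \<le> \<delta> t \<omega>"
          using elim(1) by (intro cINF_lower bdd_belowI2[of _ 0]) auto
        then have "(INF t. \<delta> t \<omega>) * (P\<theta> t \<omega> * (1 - P\<theta> t \<omega>)) \<le> \<delta> t \<omega> * (P\<theta> t \<omega> * (1 - P\<theta> t \<omega>))"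
          using X_01[OF elim(3), of t] by (intro mult_right_mono) auto
        also have "\<dots> \<le> C t \<omega> - P\<theta> t \<omega>"
          using elim(1) by blast
        finally show ?thesis .
      qed
      with elim(2) show ?case
        by blast
    qed
  qed
  have "AE \<omega> in P. lim (\<lambda>t. P\<theta> t \<omega>) = 1"
    using AE_tendsto_1 by eventually_elim (rule limI)
  moreover have "{\<omega> \<in> space P. lim (\<lambda>t. P\<theta> t \<omega>) = 1} \<in> events"
    by measurable
  ultimately have "prob {\<omega> \<in> space P. lim (\<lambda>t. P\<theta> t \<omega>) = 1} = 1"
    by (simp add: prob_Collect_eq_1)
  \<comment> \<open>For a divergent sequence \<open>lim\<close> is an unspecified value, so
    convergence is supplied as a conjunct of its own.\<close>
  then show ?thesis
    using AE_convergent by simp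
qed

end
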